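(* Let $k\ge 2$ be an integer, let $G$ be a graph, and let $c$ be a neighborhood-balanced $k$-coloring of $G$ with color classes $V_1,V_2,\dots,V_k$. Then for all $i,j\in\{1,\dots,k\}$ with $i\neq j$, $$|E(V_i,V_j)|=\frac{2|E(G)|}{k^2},$$ and for all $i\in\{1,\dots,k\}$, $$|E(V_i,V_i)|=\frac{|E(G)|}{k^2}.$$
   Context: All graphs are finite, simple and undirected. A neighborhood-balanced $k$-coloring of $G$ is a (not necessarily proper) vertex coloring $c\colon V(G)\to\{1,\dots,k\}$ such that every vertex $v$ has the same number of neighbors of each color, i.e. $|\{u\in N(v):c(u)=i\}|$ does not depend on $i\in\{1,\dots,k\}$. The color classes are $V_i=\{v\in V(G):c(v)=i\}$. For $X,Y\subseteq V(G)$, $E(X,Y)$ denotes the set of edges of $G$ joining a vertex of $X$ to a vertex of $Y$; in particular $E(X,X)$ is the set of edges with both endpoints in $X$. *)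

theory Defs
  imports Complex_Main
begin

text \<open>A graph is a vertex set together with a set of edges, each edge being the two-element set
  of its endpoints. The empty vertex set is allowed.\<close>

definition simple_graph :: "'a set \<Rightarrow> 'a set set \<Rightarrow> bool" where
  "simple_graph V E \<longleftrightarrow> finite V \<and> (\<forall>e\<in>E. e \<subseteq> V \<and> card e = 2)"

definition neighborhood :: "'a set \<Rightarrow> 'a set set \<Rightarrow> 'a \<Rightarrow> 'a set" where
  "neighborhood V E v = {u \<in> V. {u, v} \<in> E}"

text \<open>Only the values of the coloring on the vertex set matter.\<close>

definition neighborhood_balanced_coloring ::
    "'a set \<Rightarrow> 'a set set \<Rightarrow> nat \<Rightarrow> ('a \<Rightarrow> nat) \<Rightarrow> bool" where
  "neighborhood_balanced_coloring V E k c \<longleftrightarrow>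
     c ` V \<subseteq> {1..k} \<and>
     (\<forall>v\<in>V. \<forall>i\<in>{1..k}. \<forall>j\<in>{1..k}.
        card {u \<in> neighborhood V E v. c u = i} = card {u \<in> neighborhood V E v. c u = j})"

definition color_class :: "'a set \<Rightarrow> ('a \<Rightarrow> nat) \<Rightarrow> nat \<Rightarrow> 'a set" where
  "color_class V c i = {v \<in> V. c v = i}"

text \<open>Edges are unordered, so an edge inside \<open>X\<close> is counted once in \<open>edges_between E X X\<close>.\<close>

definition edges_between :: "'a set set \<Rightarrow> 'a set \<Rightarrow> 'a set \<Rightarrow> 'a set set" where
  "edges_between E X Y = {e \<in> E. \<exists>x\<in>X. \<exists>y\<in>Y. e = {x, y}}"

end

theory Submission
  imports Defs
begin

text \<open>
  Count darts, that is, edges together with an orientation. Let \<open>a\<^sub>i\<^sub>j\<close> be the number of darts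
  from color class \<open>i\<close> to color class \<open>j\<close>. Counting by the initial vertex,
  balancedness says that \<open>a\<^sub>i\<^sub>j\<close> does not depend on \<open>j\<close>; reversal of darts gives
  \<open>a\<^sub>i\<^sub>j = a\<^sub>j\<^sub>i\<close>. A symmetric matrix whose rows are constant has all its entries equal, and here
  the \<open>k\<^sup>2\<close> entries add up to the number \<open>2 \<cdot> card E\<close> of all darts, so each is
  \<open>2 \<cdot> card E / k\<^sup>2\<close>. Between two different classes every edge carries exactly one dart in the
  given direction (\<open>card_darts_disjoint\<close>); inside a class it carries two (\<open>card_darts_self\<close>),
  which accounts for the two different formulas.
\<close>

definition darts :: "'a set set \<Rightarrow> 'a set \<Rightarrow> 'a set \<Rightarrow> ('a \<times> 'a) set" where
  "darts E X Y = {(x, y). x \<in> X \<and> y \<in> Y \<and> {x, y} \<in> E}"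

lemma finite_darts: "finite X \<Longrightarrow> finite Y \<Longrightarrow> finite (darts E X Y)"
  by (rule finite_subset[of _ "X \<times> Y"]) (auto simp: darts_def)

lemma edges_between_eq_image_darts:
  "edges_between E X Y = (\<lambda>(x, y). {x, y}) ` darts E X Y"
  by (auto simp: edges_between_def darts_def image_iff)

lemma edges_between_all:
  assumes "simple_graph V E"
  shows "edges_between E V V = E"
proof
  show "E \<subseteq> edges_between E V V"
  proof
    fix e assume e: "e \<in> E"
    then have "e \<subseteq> V" "card e = 2"
      using assms by (auto simp: simple_graph_def)
    then obtain x y where "e = {x, y}" "x \<in> V" "y \<in> V"
      by (auto simp: card_2_iff)
    with e show "e \<in> edges_between E V V"
      by (auto simp: edges_between_def)
  qed
qed (auto simp: edges_between_def)

text \<open>Disjointness determines which endpoint of an edge comes first.\<close>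

lemma card_darts_disjoint:
  assumes "X \<inter> Y = {}"
  shows "card (darts E X Y) = card (edges_between E X Y)"
proof -
  have "inj_on (\<lambda>(x, y). {x, y}) (darts E X Y)"
    using assms by (auto simp: inj_on_def darts_def doubleton_eq_iff)
  then show ?thesis
    by (simp add: edges_between_eq_image_darts card_image)
qed

text \<open>As there are no loops, the map forgetting the orientation is two-to-one.\<close>

lemma card_darts_self:
  assumes "finite X" and two: "\<And>e. e \<in> E \<Longrightarrow> card e = 2"
  shows "card (darts E X X) = 2 * card (edges_between E X X)"
proof -
  let ?F = "edges_between E X X"
  let ?fibre = "\<lambda>e. {(x, y). {x, y} = e}"
  have fibre: "finite (?fibre e) \<and> card (?fibre e) = 2" if "e \<in> ?F" for e
  proof -
    from that have "card e = 2"
      using two by (auto simp: edges_between_def)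
    then obtain a b where "e = {a, b}" "a \<noteq> b"
      by (auto simp: card_2_iff)
    then have "?fibre e = {(a, b), (b, a)}"
      by (auto simp: doubleton_eq_iff)
    with \<open>a \<noteq> b\<close> show ?thesis by simp
  qed
  have "finite ?F"
    by (simp add: edges_between_eq_image_darts finite_darts assms(1))
  have "darts E X X = (\<Union>e\<in>?F. ?fibre e)"
    by (auto simp: darts_def edges_between_def doubleton_eq_iff)
  also have "card \<dots> = (\<Sum>e\<in>?F. card (?fibre e))"
    using \<open>finite ?F\<close> fibre by (intro card_UN_disjoint) auto
  also have "\<dots> = 2 * card ?F"
    using fibre by simp
  finally show ?thesis .
qed

lemma card_darts_commute: "card (darts E X Y) = card (darts E Y X)"
  by (rule bij_betw_same_card[of prod.swap], rule bij_betw_byWitness[of _ prod.swap])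
     (auto simp: darts_def insert_commute)

lemma card_darts_eq_sum:
  assumes "finite X" "finite Y"
  shows "card (darts E X Y) = (\<Sum>x\<in>X. card {y \<in> Y. {x, y} \<in> E})"
proof -
  have "darts E X Y = (SIGMA x:X. {y \<in> Y. {x, y} \<in> E})"
    by (auto simp: darts_def)
  then show ?thesis using assms by simp
qed

text \<open>Balancedness gives the equality for the darts leaving each single vertex of \<open>X\<close>. With a
  color class for \<open>X\<close>, it says that each row of the matrix \<open>a\<^sub>i\<^sub>j\<close> is constant.\<close>

lemma balanced_card_darts_target:
  assumes "simple_graph V E" and "neighborhood_balanced_coloring V E k c"
    and "X \<subseteq> V" and "i \<in> {1..k}" "j \<in> {1..k}"
  shows "card (darts E X (color_class V c i)) = card (darts E X (color_class V c j))"
proof -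
  have fin: "finite V" using assms(1) by (simp add: simple_graph_def)
  have finX: "finite X" using fin assms(3) by (rule rev_finite_subset)
  have finC: "finite (color_class V c l)" for l
    using fin by (simp add: color_class_def)
  have nbrs: "{y \<in> color_class V c l. {x, y} \<in> E} = {u \<in> neighborhood V E x. c u = l}" for x l
    by (auto simp: color_class_def neighborhood_def insert_commute)
  show ?thesis
    unfolding card_darts_eq_sum[OF finX finC] nbrs
  proof (rule sum.cong[OF refl])
    fix x assume "x \<in> X"
    with assms(3) have "x \<in> V" by blast
    with assms(2,4,5) show "card {u \<in> neighborhood V E x. c u = i} =
        card {u \<in> neighborhood V E x. c u = j}"
      unfolding neighborhood_balanced_coloring_def by blast
  qed
qed

lemma card_darts_eq_sum_color_classes:
  assumes "finite V" and "c ` V \<subseteq> {1..k}"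
  shows "card (darts E V V) =
    (\<Sum>i\<in>{1..k}. \<Sum>j\<in>{1..k}. card (darts E (color_class V c i) (color_class V c j)))"
proof -
  let ?D = "\<lambda>(i, j). darts E (color_class V c i) (color_class V c j)"
  have fin: "finite (?D p)" for p
    using assms(1) by (auto simp: color_class_def intro!: finite_darts split: prod.split)
  have "darts E V V = (\<Union>p\<in>{1..k} \<times> {1..k}. ?D p)"
    using assms(2) by (fastforce simp: darts_def color_class_def)
  also have "card \<dots> = (\<Sum>p\<in>{1..k} \<times> {1..k}. card (?D p))"
    using fin by (intro card_UN_disjoint) (auto simp: darts_def color_class_def)
  finally show ?thesis
    by (simp add: sum.cartesian_product split_def)
qed

lemma balanced_card_darts:
  assumes G: "simple_graph V E" and bal: "neighborhood_balanced_coloring V E k c"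
    and i: "i \<in> {1..k}" and j: "j \<in> {1..k}"
  shows "k\<^sup>2 * card (darts E (color_class V c i) (color_class V c j)) = 2 * card E"
proof -
  let ?a = "\<lambda>i j. card (darts E (color_class V c i) (color_class V c j))"
  have fin: "finite V" and two: "\<And>e. e \<in> E \<Longrightarrow> card e = 2"
    using G by (auto simp: simple_graph_def)
  have row: "?a p q = ?a p q'" if "q \<in> {1..k}" "q' \<in> {1..k}" for p q q'
    using that by (intro balanced_card_darts_target[OF G bal]) (auto simp: color_class_def)
  have const: "?a p q = ?a i j" if "p \<in> {1..k}" "q \<in> {1..k}" for p q
  proof -
    have "?a p q = ?a p i" using that i by (intro row)
    also have "\<dots> = ?a i p" by (rule card_darts_commute)
    also have "\<dots> = ?a i j" using that j by (intro row)
    finally show ?thesis .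
  qed
  have "2 * card E = card (darts E V V)"
    using card_darts_self[of V E, OF fin two] by (simp add: edges_between_all[OF G])
  also have "\<dots> = (\<Sum>p\<in>{1..k}. \<Sum>q\<in>{1..k}. ?a p q)"
    using bal unfolding neighborhood_balanced_coloring_def
    by (intro card_darts_eq_sum_color_classes fin) (rule conjunct1)
  also have "\<dots> = (\<Sum>p\<in>{1..k}. \<Sum>q\<in>{1..k}. ?a i j)"
    by (intro sum.cong refl const)
  also have "\<dots> = k\<^sup>2 * ?a i j"
    by (simp add: power2_eq_square)
  finally show ?thesis by simp
qed

theorem theorem2p4:
  fixes V :: "'a set" and E :: "'a set set" and c :: "'a \<Rightarrow> nat" and k :: nat
  assumes "k \<ge> 2"
    and "simple_graph V E"
    and "neighborhood_balanced_coloring V E k c"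
  shows "(\<forall>i\<in>{1..k}. \<forall>j\<in>{1..k}. i \<noteq> j \<longrightarrow>
            real (card (edges_between E (color_class V c i) (color_class V c j)))
              = 2 * real (card E) / (real k)\<^sup>2) \<and>
         (\<forall>i\<in>{1..k}.
            real (card (edges_between E (color_class V c i) (color_class V c i)))
              = real (card E) / (real k)\<^sup>2)"
proof -
  let ?C = "color_class V c"
  have k: "(real k)\<^sup>2 \<noteq> 0" using assms(1) by simp
  have count: "real (card (darts E (?C i) (?C j))) = 2 * real (card E) / (real k)\<^sup>2"
    if "i \<in> {1..k}" "j \<in> {1..k}" for i j
  proof -
    have "real (k\<^sup>2 * card (darts E (?C i) (?C j))) = real (2 * card E)"
      using balanced_card_darts[OF assms(2,3) that] by (rule arg_cong)
    with k show ?thesis by (simp add: eq_divide_eq mult.commute)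
  qed
  have between: "card (darts E (?C i) (?C j)) = card (edges_between E (?C i) (?C j))"
    if "i \<noteq> j" for i j
    using that by (intro card_darts_disjoint) (auto simp: color_class_def)
  have inside: "card (darts E (?C i) (?C i)) = 2 * card (edges_between E (?C i) (?C i))" for i
    using assms(2) by (intro card_darts_self) (auto simp: color_class_def simple_graph_def)
  show ?thesis
  proof (intro conjI ballI impI)
    fix i j assume "i \<in> {1..k}" "j \<in> {1..k}" "i \<noteq> j"
    then show "real (card (edges_between E (?C i) (?C j))) = 2 * real (card E) / (real k)\<^sup>2"
      using count[of i j] between[of i j] by simp
  next
    fix i assume "i \<in> {1..k}"
    then show "real (card (edges_between E (?C i) (?C i))) = real (card E) / (real k)\<^sup>2"
      using count[of i i] by (simp add: inside)
  qed
qed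

end
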